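(* For every integer $s \geq 1$ and every integer $N \geq 1$ there exist points $z_1,\ldots,z_N$ in the $s$-dimensional unit cube $[0,1]^s$ such that $$D_N^*(z_1,\ldots,z_N) < 9\,\frac{\sqrt{s}}{\sqrt{N}}.$$
   Context: For points $z_1,\ldots,z_N \in [0,1]^s$, the star-discrepancy is $$D_N^*(z_1,\ldots,z_N) := \sup_{B} \left| \frac{A_N(B)}{N} - \lambda_s(B) \right|,$$ where the supremum is over all boxes $B = [0,a_1)\times[0,a_2)\times\cdots\times[0,a_s) \subseteq [0,1]^s$ anchored at the origin, $A_N(B) := |\{ n : 1 \leq n \leq N,\ z_n \in B\}|$, and $\lambda_s$ denotes $s$-dimensional Lebesgue measure. *)

theory Defs
  imports "HOL-Analysis.Analysis"
begin

(* Written componentwise: the strict order on vectors in the library is not the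
   componentwise one, so {0..<a} would be a different set. *)
definition anchored_box :: "real ^ 's \<Rightarrow> (real ^ 's) set" where
  "anchored_box a = {x. \<forall>i. 0 \<le> x $ i \<and> x $ i < a $ i}"

definition box_count :: "nat \<Rightarrow> (nat \<Rightarrow> real ^ 's) \<Rightarrow> (real ^ 's) set \<Rightarrow> nat" where
  "box_count N z B = card {n. 1 \<le> n \<and> n \<le> N \<and> z n \<in> B}"

(* Only z 1, ..., z N matter. The supremum is over a nonempty set of
   reals in [0,1] (see star_discrepancy_bdd), so the conditionally complete Sup is the
   usual one. *)
definition star_discrepancy :: "nat \<Rightarrow> (nat \<Rightarrow> real ^ 's) \<Rightarrow> real" where
  "star_discrepancy N z =
     (SUP B \<in> anchored_box ` cbox 0 1. \<bar>real (box_count N z B) / real N - measure lebesgue B\<bar>)"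

lemma star_discrepancy_bdd:
  fixes z :: "nat \<Rightarrow> real ^ 's"
  assumes a: "a \<in> cbox 0 (1 :: real ^ 's)"
  shows "\<bar>real (box_count N z (anchored_box a)) / real N - measure lebesgue (anchored_box a)\<bar> \<le> 1"
proof -
  have sub: "anchored_box a \<subseteq> cbox 0 1"
  proof
    fix x assume "x \<in> anchored_box a"
    then have x: "0 \<le> x $ i" "x $ i < a $ i" for i
      by (auto simp: anchored_box_def)
    have "a $ i \<le> 1" for i
      using a by (simp add: mem_box_cart)
    then have "x $ i \<le> 1" for i
      using x(2)[of i] by (meson less_imp_le order_trans)
    then show "x \<in> cbox 0 1"
      using x(1) by (simp add: mem_box_cart)
  qed
  have unit: "measure lebesgue (cbox 0 (1 :: real ^ 's)) = 1"
    using content_cbox_if_cart[of 0 "1 :: real ^ 's"] by (simp add: interval_ne_empty_cart)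
  have "measure lebesgue (anchored_box a) \<le> 1"
  proof (cases "anchored_box a \<in> sets lebesgue")
    case True
    then have "measure lebesgue (anchored_box a) \<le> measure lebesgue (cbox 0 (1 :: real ^ 's))"
      by (intro measure_mono_fmeasurable[OF sub]) auto
    then show ?thesis
      using unit by linarith
  next
    case False
    then show ?thesis
      by (simp add: measure_notin_sets)
  qed
  moreover have "box_count N z (anchored_box a) \<le> card {1..N}"
    unfolding box_count_def by (intro card_mono) auto
  then have "real (box_count N z (anchored_box a)) / real N \<le> 1"
    by (cases "N = 0") (auto simp: divide_le_eq_1)
  moreover have "0 \<le> measure lebesgue (anchored_box a)"
    by simp
  moreover have "0 \<le> real (box_count N z (anchored_box a)) / real N"
    by simp
  ultimately show ?thesis
    by linarith
qed

end

(* The bound is trivial for N < 81 s, so let eps = sqrt (s / N) <= 1 / 9. Chaining: for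
   m = 5, 6, ... take a finite net of boxes approximating every anchored box up to volume 4^(-m).
   A box of level m is a box of level m - 1 plus a set of measure at most 4^(1-m), so a union bound
   over Bernstein-type exponential moments controls level 5 by 7.2 eps and the increments of all
   higher levels by 0.53 eps in total. The chain stops as soon as 4^(-m) <= eps, where
   monotonicity of the counts passes from the net to arbitrary boxes at cost eps. The sum is
   below 9 eps. *)

theory Submission
  imports Defs "HOL-Probability.Probability_Measure"
begin

section \<open>Points with small deviations\<close>

text \<open>With a single net of fineness \<epsilon>, the union bound would lose a factor
  sqrt(ln(1/\<epsilon>)) against sqrt(s/N). Chaining avoids the loss because a set of measure p
  fluctuates only like sqrt(p): relative to \<epsilon>, the threshold at level m is at most a
  multiple of m 2^(-m), which is summable although the nets grow exponentially with m. Two points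
  are essential. The moment bound has to keep the measure of the set in its exponent. And the
  logarithm of the net size has to be s times a function of the fineness alone, since a further ln s
  would spoil the constant. The moment bound holds only for rates up to 1, while the natural rate at
  level m is about \<epsilon> 2^(m-1) times a linear function of m. This is admissible as long as
  the preceding level still has 4^(1-m) > \<epsilon>, so the chain can be run exactly until the
  approximation error drops to \<epsilon>.\<close>

lemma exp_le_quadratic:
  fixes x :: real
  assumes "\<bar>x\<bar> \<le> 1"
  shows "exp x \<le> 1 + x + x\<^sup>2"
proof (cases "x \<ge> 0")
  case True
  then show ?thesis using exp_bound[of x] assms by simp
next
  case False
  define y where "y = - x"
  have y: "0 \<le> y" using False by (simp add: y_def)
  \<comment> \<open>For x = -y the claim amounts to 1 \<le> exp y (1 - y + y^2), where the quadratic
    Taylor polynomial is a good enough lower bound for exp y.\<close>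
  have "1 \<le> (1 + y + y\<^sup>2 / 2) * (1 - y + y\<^sup>2)"
  proof -
    have "(1 + y + y\<^sup>2 / 2) * (1 - y + y\<^sup>2) = 1 + y^2/2 + y^3/2 + y^4/2"
      by (simp add: field_simps power2_eq_square power3_eq_cube power4_eq_xxxx)
    then show ?thesis using y by simp
  qed
  also have "\<dots> \<le> exp y * (1 - y + y\<^sup>2)"
  proof (rule mult_right_mono)
    show "1 + y + y\<^sup>2 / 2 \<le> exp y" using y exp_lower_Taylor_quadratic by blast
    show "0 \<le> 1 - y + y\<^sup>2" using assms False by (simp add: y_def)
  qed
  finally have "exp (- y) \<le> 1 - y + y\<^sup>2"
    by (simp add: exp_minus field_simps)
  then show ?thesis by (simp add: y_def)
qed

lemma (in prob_space) exists_le_expectation: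
  fixes f :: "'a \<Rightarrow> real"
  assumes "integrable M f"
  shows "\<exists>x\<in>space M. f x \<le> expectation f"
proof (rule ccontr)
  assume "\<not> ?thesis"
  then have "\<And>x. x \<in> space M \<Longrightarrow> expectation f < f x" by force
  then have "expectation (\<lambda>_. expectation f) < expectation f"
    by (intro integral_less_AE_space) (auto simp: assms emeasure_space_1)
  then show False by (simp add: prob_space)
qed

text \<open>The exponential is affine in the indicator, so its mean is explicit. The factor
  \<open>prob S\<close> in the exponent makes this a Bernstein bound rather than a Hoeffding bound:
  small sets get a proportionally smaller exponent, which is what the increments of the chain
  need.\<close>

lemma (in prob_space)
  fixes l :: real
  assumes S: "S \<in> events"
  shows integrable_exp_indicator:
      "integrable M (\<lambda>z. exp (l * (indicator S z - prob S)))"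
    and expectation_exp_indicator_le:
      "\<bar>l\<bar> \<le> 1 \<Longrightarrow> expectation (\<lambda>z. exp (l * (indicator S z - prob S))) \<le> exp (l\<^sup>2 * prob S)"
proof -
  have eq: "exp (l * (indicator S z - prob S)) = exp (- l * prob S) * (1 + (exp l - 1) * indicator S z)" for z
    by (simp add: indicator_def exp_minus exp_diff right_diff_distrib field_simps)
  have int: "integrable M (indicat_real S)"
    using S by (simp add: less_top[symmetric])
  show "integrable M (\<lambda>z. exp (l * (indicator S z - prob S)))"
    unfolding eq using int by simp
  assume l: "\<bar>l\<bar> \<le> 1"
  have "expectation (\<lambda>z. exp (l * (indicator S z - prob S))) = exp (- l * prob S) * (1 + (exp l - 1) * prob S)"
    unfolding eq using int S by (simp add: prob_space)
  also have "\<dots> \<le> exp (- l * prob S) * exp ((exp l - 1) * prob S)"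
    by (intro mult_left_mono) auto
  also have "\<dots> = exp ((exp l - 1 - l) * prob S)"
    by (simp add: algebra_simps flip: exp_add)
  also have "\<dots> \<le> exp (l\<^sup>2 * prob S)"
    using exp_le_quadratic[OF l] by (simp add: mult_right_mono)
  finally show "expectation (\<lambda>z. exp (l * (indicator S z - prob S))) \<le> exp (l\<^sup>2 * prob S)" .
qed

text \<open>
  The points are chosen one after the other, each at most the average of the current potential,
  so that no product measure is needed.
\<close>

lemma (in prob_space) exists_points_exp_moment_le:
  fixes c l :: "'j \<Rightarrow> real"
  assumes J: "finite J" "\<And>j. j \<in> J \<Longrightarrow> S j \<in> events" "\<And>j. j \<in> J \<Longrightarrow> \<bar>l j\<bar> \<le> 1"
    and c: "\<And>j. j \<in> J \<Longrightarrow> 0 \<le> c j"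
  shows "\<exists>z. (\<forall>n. z n \<in> space M) \<and>
    (\<Sum>j\<in>J. c j * exp (l j * (\<Sum>n=1..N. indicator (S j) (z n) - prob (S j))))
      \<le> (\<Sum>j\<in>J. c j * exp (real N * ((l j)\<^sup>2 * prob (S j))))"
  using c
proof (induction N arbitrary: c)
  case 0
  obtain x where "x \<in> space M" using not_empty by blast
  then show ?case by (auto intro!: exI[of _ "\<lambda>_. x"])
next
  case (Suc N)
  \<comment> \<open>The cost of the next point is paid in advance by enlarging the weights; this is
    why the induction runs over arbitrary \<open>c\<close>.\<close>
  define b where "b j = c j * exp ((l j)\<^sup>2 * prob (S j))" for j
  obtain z where z: "\<And>n. z n \<in> space M"
    "(\<Sum>j\<in>J. b j * exp (l j * (\<Sum>n=1..N. indicator (S j) (z n) - prob (S j))))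
      \<le> (\<Sum>j\<in>J. b j * exp (real N * ((l j)\<^sup>2 * prob (S j))))"
    using Suc.IH[of b] Suc.prems by (auto simp: b_def)
  define a where "a j = c j * exp (l j * (\<Sum>n=1..N. indicator (S j) (z n) - prob (S j)))" for j
  have a: "j \<in> J \<Longrightarrow> 0 \<le> a j" for j using Suc.prems by (simp add: a_def)
  let ?f = "\<lambda>x. \<Sum>j\<in>J. a j * exp (l j * (indicator (S j) x - prob (S j)))"
  have "integrable M ?f" using J(2) by (intro Bochner_Integration.integrable_sum integrable_mult_right integrable_exp_indicator)
  then obtain x where x: "x \<in> space M" "?f x \<le> expectation ?f"
    using exists_le_expectation by blast
  note x(2)
  also have "expectation ?f = (\<Sum>j\<in>J. a j * expectation (\<lambda>x. exp (l j * (indicator (S j) x - prob (S j)))))"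
    using J integrable_exp_indicator by (simp add: Bochner_Integration.integral_sum)
  also have "\<dots> \<le> (\<Sum>j\<in>J. a j * exp ((l j)\<^sup>2 * prob (S j)))"
    using J a by (intro sum_mono mult_left_mono expectation_exp_indicator_le) auto
  also have "\<dots> = (\<Sum>j\<in>J. b j * exp (l j * (\<Sum>n=1..N. indicator (S j) (z n) - prob (S j))))"
    by (simp add: a_def b_def mult_ac)
  also note z(2)
  also have "(\<Sum>j\<in>J. b j * exp (real N * ((l j)\<^sup>2 * prob (S j))))
      = (\<Sum>j\<in>J. c j * exp (real (Suc N) * ((l j)\<^sup>2 * prob (S j))))"
    by (simp add: b_def algebra_simps exp_add)
  finally have le: "?f x \<le> \<dots>" .
  have eq: "a j * exp (l j * (indicator (S j) x - prob (S j)))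
      = c j * exp (l j * (\<Sum>n=1..Suc N. indicator (S j) ((z(Suc N := x)) n) - prob (S j)))" for j
  proof -
    have "(\<Sum>n=1..N. indicator (S j) ((z(Suc N := x)) n) - prob (S j)) = (\<Sum>n=1..N. indicator (S j) (z n) - prob (S j))"
      by (intro sum.cong) auto
    then show ?thesis
      by (simp add: a_def distrib_left exp_add)
  qed
  show ?case
    using le x(1) z(1) unfolding eq by (intro exI[of _ "z(Suc N := x)"]) auto
qed

text \<open>Union bound in potential form. Every set enters with both signs of \<open>l j\<close>,
  hence the factor 2, and the weights are normalised so that one deviation of size
  \<open>real N * t j\<close> would alone contribute at least 1 to the potential.\<close>

lemma (in prob_space) exists_points_deviation_less:
  fixes l t :: "'j \<Rightarrow> real"
  assumes J: "finite J" "\<And>j. j \<in> J \<Longrightarrow> S j \<in> events"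
    and l: "\<And>j. j \<in> J \<Longrightarrow> 0 < l j \<and> l j \<le> 1"
    and less: "(\<Sum>j\<in>J. 2 * exp (real N * ((l j)\<^sup>2 * prob (S j) - l j * t j))) < 1"
  shows "\<exists>z. (\<forall>n. z n \<in> space M) \<and>
    (\<forall>j\<in>J. \<bar>(\<Sum>n=1..N. indicator (S j) (z n)) - real N * prob (S j)\<bar> < real N * t j)"
proof -
  define c where "c j = exp (- real N * (l j * t j))" for j
  define dev where "dev z j = (\<Sum>n=1..N. indicator (S j) (z n)) - real N * prob (S j)" for z j
  obtain z where z: "\<And>n. z n \<in> space M" and
    "(\<Sum>(\<sigma>, j)\<in>{1, -1} \<times> J. c j * exp (\<sigma> * l j * (\<Sum>n=1..N. indicator (S j) (z n) - prob (S j))))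
      \<le> (\<Sum>(\<sigma>, j)\<in>{1, -1} \<times> J. c j * exp (real N * ((\<sigma> * l j)\<^sup>2 * prob (S j))))"
    using exists_points_exp_moment_le[of "{1, -1} \<times> J" "\<lambda>(\<sigma>, j). S j" "\<lambda>(\<sigma>, j). \<sigma> * l j" "\<lambda>(\<sigma>, j). c j" N] J l
    by (fastforce simp: c_def case_prod_beta abs_le_iff)
  then have "(\<Sum>j\<in>J. c j * exp (l j * dev z j) + c j * exp (- l j * dev z j))
      \<le> (\<Sum>j\<in>J. 2 * (c j * exp (real N * ((l j)\<^sup>2 * prob (S j)))))"
    by (simp add: sum.cartesian_product[symmetric] dev_def sum_subtractf sum.distrib sum_distrib_left)
  also have "\<dots> = (\<Sum>j\<in>J. 2 * exp (real N * ((l j)\<^sup>2 * prob (S j) - l j * t j)))"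
    by (simp add: c_def algebra_simps flip: exp_add)
  also note less
  finally have lt1: "(\<Sum>j\<in>J. c j * exp (l j * dev z j) + c j * exp (- l j * dev z j)) < 1" .
  have "\<bar>dev z j\<bar> < real N * t j" if j: "j \<in> J" for j
  proof -
    have "c j * exp (l j * dev z j) + c j * exp (- l j * dev z j) < 1"
      using lt1 J(1) j
      by (intro le_less_trans[OF member_le_sum lt1]) (auto simp: c_def)
    moreover have "0 < c j * exp (l j * dev z j)" "0 < c j * exp (- l j * dev z j)"
      by (auto simp: c_def)
    ultimately have "c j * exp (l j * dev z j) < 1" "c j * exp (- l j * dev z j) < 1"
      by linarith+
    then have "l j * dev z j < l j * (real N * t j)" "l j * (- dev z j) < l j * (real N * t j)"
      by (simp_all add: c_def algebra_simps flip: exp_add)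
    then have "dev z j < real N * t j" "- dev z j < real N * t j"
      using l[OF j] by (simp_all only: mult_less_cancel_left_pos)
    then show ?thesis by linarith
  qed
  then show ?thesis using z by (auto simp: dev_def)
qed

section \<open>Anchored boxes\<close>

lemma anchored_box_borel [measurable]: "anchored_box a \<in> sets borel"
proof -
  have "anchored_box a = (\<Inter>i. {x. 0 \<le> x $ i} \<inter> {x. x $ i < a $ i})"
    by (auto simp: anchored_box_def)
  moreover have "{x. 0 \<le> x $ i} \<inter> {x. x $ i < a $ i} \<in> sets borel" for i
    by (intro sets.Int borel_closed borel_open closed_Collect_le open_Collect_less continuous_intros)
  ultimately show ?thesis
    by (simp add: sets.countable_INT'')
qed

lemma measure_anchored_box:
  fixes a :: "real ^ 's"
  assumes "\<And>i. 0 \<le> a $ i"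
  shows "measure lebesgue (anchored_box a) = (\<Prod>i\<in>UNIV. a $ i)"
proof -
  have sub: "box 0 a \<subseteq> anchored_box a" "anchored_box a \<subseteq> cbox 0 a"
  proof -
    show "box 0 a \<subseteq> anchored_box a"
    proof
      fix x assume "x \<in> box 0 a"
      then have "0 \<le> x $ i" "x $ i < a $ i" for i
        using less_imp_le[of 0 "x $ i"] by (simp_all add: mem_box_cart)
      then show "x \<in> anchored_box a" by (simp add: anchored_box_def)
    qed
    show "anchored_box a \<subseteq> cbox 0 a"
    proof
      fix x assume "x \<in> anchored_box a"
      then have "0 \<le> x $ i" "x $ i \<le> a $ i" for i
        using less_imp_le[of "x $ i" "a $ i"] by (simp_all add: anchored_box_def)
      then show "x \<in> cbox 0 a" by (simp add: mem_box_cart)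
    qed
  qed
  have "anchored_box a \<in> lmeasurable"
    by (rule fmeasurableI2[OF _ sub(2)]) auto
  then have "measure lebesgue (box 0 a) \<le> measure lebesgue (anchored_box a)"
    by (rule measure_mono_fmeasurable[OF sub(1), rotated]) auto
  moreover have "measure lebesgue (anchored_box a) \<le> measure lebesgue (cbox 0 a)"
    by (rule measure_mono_fmeasurable[OF sub(2)]) auto
  moreover have "a \<in> cbox 0 a" using assms by (simp add: mem_box_cart)
  then have "measure lebesgue (cbox 0 a) = (\<Prod>i\<in>UNIV. a $ i)"
    by (auto simp: content_cbox_if_cart)
  moreover have "measure lebesgue (box 0 a) = measure lebesgue (cbox 0 a)"
    by (simp add: measure_lborel_box_eq measure_lborel_cbox_eq)
  ultimately show ?thesis by simp
qed

lemma anchored_box_subset_unit: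
  assumes "a \<in> cbox 0 1"
  shows "anchored_box a \<subseteq> cbox 0 1"
proof
  fix x assume "x \<in> anchored_box a"
  then have "0 \<le> x $ i" "x $ i < a $ i" "a $ i \<le> 1" for i
    using assms by (auto simp: anchored_box_def mem_box_cart)
  then show "x \<in> cbox 0 1"
    by (simp add: mem_box_cart) (meson less_imp_le order_trans)
qed

lemma anchored_box_lmeasurable: "a \<in> cbox 0 1 \<Longrightarrow> anchored_box a \<in> lmeasurable"
  by (rule fmeasurableI2[OF _ anchored_box_subset_unit]) auto

lemma box_count_Diff:
  assumes "B \<subseteq> C"
  shows "real (box_count N z (C - B)) = real (box_count N z C) - real (box_count N z B)"
proof -
  let ?I = "\<lambda>A. {n. 1 \<le> n \<and> n \<le> N \<and> z n \<in> A}"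
  have fin: "finite (?I C)" by simp
  have sub: "?I B \<subseteq> ?I C" using assms by auto
  have "?I (C - B) = ?I C - ?I B" by auto
  then have "box_count N z (C - B) = box_count N z C - box_count N z B"
    unfolding box_count_def by (simp only: card_Diff_subset[OF finite_subset[OF sub fin] sub])
  moreover have "box_count N z B \<le> box_count N z C"
    unfolding box_count_def by (rule card_mono[OF fin sub])
  ultimately show ?thesis by (simp only: of_nat_diff)
qed

lemma box_count_mono: "B \<subseteq> C \<Longrightarrow> box_count N z B \<le> box_count N z C"
  unfolding box_count_def by (intro card_mono) auto

lemma anchored_box_mono:
  assumes "\<And>i. a $ i \<le> b $ i"
  shows "anchored_box a \<subseteq> anchored_box b"
proof
  fix x assume "x \<in> anchored_box a"
  then have "0 \<le> x $ i" "x $ i < a $ i" for i by (simp_all add: anchored_box_def)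
  moreover from this(2) have "x $ i < b $ i" for i using assms by (rule less_le_trans)
  ultimately show "x \<in> anchored_box b" by (simp add: anchored_box_def)
qed

lemma anchored_box_eq_empty:
  assumes "a $ i \<le> 0"
  shows "anchored_box a = {}"
proof (rule equals0I)
  fix x assume "x \<in> anchored_box a"
  then have "0 \<le> x $ i" "x $ i < a $ i" by (simp_all add: anchored_box_def)
  then show False using assms by linarith
qed

text \<open>The probability space is Lebesgue measure restricted to the cube; as each
  \<open>S j\<close> lies in the cube, its probability is its volume.\<close>

lemma exists_unit_cube_points_deviation_less:
  fixes l t :: "'j \<Rightarrow> real" and S :: "'j \<Rightarrow> (real ^ 's) set"
  assumes J: "finite J" "\<And>j. j \<in> J \<Longrightarrow> S j \<in> sets borel" "\<And>j. j \<in> J \<Longrightarrow> S j \<subseteq> cbox 0 1"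
    and l: "\<And>j. j \<in> J \<Longrightarrow> 0 < l j \<and> l j \<le> 1"
    and less: "(\<Sum>j\<in>J. 2 * exp (real N * ((l j)\<^sup>2 * measure lebesgue (S j) - l j * t j))) < 1"
  shows "\<exists>z. (\<forall>n. z n \<in> cbox 0 1) \<and>
    (\<forall>j\<in>J. \<bar>real (box_count N z (S j)) - real N * measure lebesgue (S j)\<bar> < real N * t j)"
proof -
  define M where "M = restrict_space lborel (cbox 0 (1 :: real ^ 's))"
  have "measure lborel (cbox 0 (1 :: real ^ 's)) = 1"
    by (simp add: content_cbox_if_cart interval_ne_empty_cart)
  then have "emeasure lborel (cbox 0 (1 :: real ^ 's)) = 1"
    using emeasure_lborel_cbox_finite[of 0 "1 :: real ^ 's"]
    by (subst emeasure_eq_ennreal_measure) auto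
  then interpret prob_space M
    unfolding M_def by (intro prob_space_restrict_space) auto
  have ev: "S j \<in> events" and prob_eq: "prob (S j) = measure lebesgue (S j)" if "j \<in> J" for j
    using J that by (auto simp: M_def sets_restrict_space_iff measure_restrict_space)
  have "(\<Sum>j\<in>J. 2 * exp (real N * ((l j)\<^sup>2 * prob (S j) - l j * t j))) < 1"
    using less by (simp add: prob_eq cong: sum.cong)
  from exists_points_deviation_less[of J S l N t, OF J(1) ev l this]
  obtain z where z: "\<And>n. z n \<in> space M"
    "\<And>j. j \<in> J \<Longrightarrow> \<bar>(\<Sum>n=1..N. indicator (S j) (z n)) - real N * prob (S j)\<bar> < real N * t j"
    by auto
  have count: "(\<Sum>n=1..N. indicator B (z n)) = real (box_count N z B)" for B
  proof -
    have "{1..N} \<inter> {n. z n \<in> B} = {n. 1 \<le> n \<and> n \<le> N \<and> z n \<in> B}" by auto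
    then show ?thesis
      by (simp add: box_count_def indicator_def sum.If_cases)
  qed
  have "\<bar>real (box_count N z (S j)) - real N * measure lebesgue (S j)\<bar> < real N * t j" if "j \<in> J" for j
    using z(2)[OF that] prob_eq[OF that] by (simp only: count)
  then show ?thesis
    using z(1) by (intro exI[of _ z]) (auto simp: M_def space_restrict_space)
qed

section \<open>Nets of boxes\<close>

text \<open>Markov's inequality for the weight $\exp(-\sum_i n_i / R)$, which factors over the coordinates.\<close>

lemma card_functions_sum_le:
  assumes R: "0 < R"
  shows "finite {n :: 's :: finite \<Rightarrow> nat. sum n UNIV \<le> R * CARD('s)}" (is "finite ?F")
    and "real (card {n :: 's \<Rightarrow> nat. sum n UNIV \<le> R * CARD('s)}) \<le> (exp 1 * (real R + 1)) ^ CARD('s)"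
proof -
  define A where "A = R * CARD('s)"
  have sub: "?F \<subseteq> (UNIV \<rightarrow>\<^sub>E {..A})"
  proof
    fix n assume "n \<in> ?F"
    moreover have "n i \<le> sum n UNIV" for i by (rule member_le_sum) auto
    ultimately show "n \<in> (UNIV \<rightarrow>\<^sub>E {..A})" using le_trans unfolding A_def by blast
  qed
  have fin: "finite (UNIV \<rightarrow>\<^sub>E {..A} :: ('s \<Rightarrow> nat) set)"
    by (intro finite_PiE) auto
  show "finite ?F"
    using sub fin by (rule finite_subset)
  \<comment> \<open>With this ratio each counted function has weight at least exp(-s), s being the
    dimension, while the geometric series in each coordinate stays below 1 / (1 - q) \<le> R +
    1.\<close>
  define q where "q = exp (- 1 / real R)"
  have q: "0 < q" "q < 1" using R by (auto simp: q_def)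
  have "1 / real R + 1 \<le> exp (1 / real R)"
    using exp_ge_add_one_self[of "1 / real R"] by linarith
  then have qinv: "1 / (1 - q) \<le> real R + 1"
    using R q by (simp add: q_def exp_minus field_simps)
  have weight: "1 \<le> exp 1 ^ CARD('s) * (\<Prod>i\<in>UNIV. q ^ n i)" if "n \<in> ?F" for n :: "'s \<Rightarrow> nat"
  proof -
    have "real (sum n UNIV) \<le> real R * real CARD('s)"
      using that by (metis (mono_tags, lifting) mem_Collect_eq of_nat_le_iff of_nat_mult)
    then have "0 \<le> real CARD('s) - real (sum n UNIV) / real R"
      using R by (simp add: field_simps)
    then have "1 \<le> exp (real CARD('s) - real (sum n UNIV) / real R)" by simp
    also have "\<dots> = exp 1 ^ CARD('s) * q ^ sum n UNIV"
      by (simp add: q_def exp_diff exp_minus field_simps flip: exp_of_nat_mult)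
    finally show ?thesis by (simp add: power_sum)
  qed
  have "real (card ?F) = (\<Sum>n\<in>?F. 1)" by simp
  also have "\<dots> \<le> (\<Sum>n\<in>?F. exp 1 ^ CARD('s) * (\<Prod>i\<in>UNIV. q ^ n i))"
    by (intro sum_mono weight)
  also have "\<dots> \<le> (\<Sum>n\<in>UNIV \<rightarrow>\<^sub>E {..A}. exp 1 ^ CARD('s) * (\<Prod>i\<in>(UNIV :: 's set). q ^ n i))"
    using q by (intro sum_mono2[OF fin sub]) (auto intro!: prod_nonneg mult_nonneg_nonneg)
  also have "\<dots> = exp 1 ^ CARD('s) * (\<Sum>k\<le>A. q ^ k) ^ CARD('s)"
    using prod_sum_PiE[of "UNIV :: 's set" "\<lambda>_. {..A}" "\<lambda>_ k. q ^ k"]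
    by (simp flip: sum_distrib_left)
  also have "\<dots> \<le> exp 1 ^ CARD('s) * (real R + 1) ^ CARD('s)"
  proof (intro mult_left_mono power_mono)
    have "(\<Sum>k\<le>A. q ^ k) = (1 - q ^ Suc A) / (1 - q)"
      using q by (subst sum_gp0) auto
    also have "\<dots> \<le> 1 / (1 - q)"
      using q by (intro divide_right_mono) auto
    finally show "(\<Sum>k\<le>A. q ^ k) \<le> real R + 1" using qinv by linarith
  qed (use q in \<open>auto intro!: sum_nonneg\<close>)
  finally show "real (card ?F) \<le> (exp 1 * (real R + 1)) ^ CARD('s)"
    by (simp add: power_mult_distrib)
qed

text \<open>Serves to lower the rounding exponents of a box of tiny volume until their sum fits the
  budget of the net.\<close>

lemma exists_le_function_sum_eq:
  fixes f :: "'s :: finite \<Rightarrow> nat"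
  assumes "k \<le> sum f UNIV"
  shows "\<exists>g. (\<forall>i. g i \<le> f i) \<and> sum g UNIV = k"
  using assms
proof (induction k)
  case 0
  then show ?case by (intro exI[of _ "\<lambda>_. 0"]) auto
next
  case (Suc k)
  then obtain g where g: "\<And>i. g i \<le> f i" "sum g UNIV = k" by auto
  have "\<exists>i. g i < f i"
  proof (rule ccontr)
    assume "\<not> ?thesis"
    then have "g = f" using g(1) by (intro ext) (meson antisym not_less)
    then show False using g(2) Suc.prems by simp
  qed
  then obtain i where i: "g i < f i" ..
  have "sum (g(i := Suc (g i))) UNIV = Suc (sum g UNIV)"
    by (simp add: sum.remove[of UNIV i])
  with g i show ?case by (intro exI[of _ "g(i := Suc (g i))"]) auto
qed

lemma exists_power_bracket:
  fixes q y :: real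
  assumes q: "0 < q" "q < 1" and y: "0 < y" "y \<le> 1"
  shows "\<exists>n. q ^ Suc n \<le> y \<and> y \<le> q ^ n"
proof -
  obtain k where k: "q ^ k < y" using real_arch_pow_inv y(1) q(2) by blast
  define n where "n = (LEAST k. q ^ k < y)"
  have n: "q ^ n < y" unfolding n_def using k by (rule LeastI)
  then have "n \<noteq> 0" using y(2) by (auto intro: Nat.gr0I)
  then obtain m where m: "n = Suc m" using not0_implies_Suc by blast
  have "\<not> q ^ m < y" using not_less_Least[of m "\<lambda>k. q ^ k < y"] m by (simp add: n_def)
  then show ?thesis using n m by (intro exI[of _ m]) auto
qed

text \<open>
  Rounding to powers of $1 - \delta/s$ costs at most $\delta$ in volume, by Bernoulli's inequality.
  Points whose exponents have a large sum bound boxes of negligible volume and are left out; this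
  is what keeps the net of size $(C \delta^{-1} \ln \delta^{-1})^s$ instead of $(s/\delta)^s$.
\<close>

definition unit_net :: "real \<Rightarrow> nat \<Rightarrow> (real ^ 's) set" where
  "unit_net \<delta> R = (\<lambda>n. \<chi> i. (1 - \<delta> / CARD('s)) ^ n i) ` {n. sum n UNIV \<le> (R + 1) * CARD('s)}"

lemma
  shows finite_unit_net: "finite (unit_net \<delta> R :: (real ^ 's) set)"
    and card_unit_net_le: "real (card (unit_net \<delta> R :: (real ^ 's) set)) \<le> (exp 1 * (real R + 2)) ^ CARD('s)"
proof -
  note * = card_functions_sum_le[of "R + 1", where 's = 's]
  show "finite (unit_net \<delta> R :: (real ^ 's) set)"
    unfolding unit_net_def using * by simp
  show "real (card (unit_net \<delta> R :: (real ^ 's) set)) \<le> (exp 1 * (real R + 2)) ^ CARD('s)"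
    unfolding unit_net_def using * by (intro order_trans[OF of_nat_mono[OF card_image_le]]) (auto simp: add.commute)
qed

context
  fixes \<delta> :: real and R :: nat
  assumes \<delta>: "0 < \<delta>" "\<delta> < 1"
begin

lemma unit_net_range:
  assumes "y \<in> (unit_net \<delta> R :: (real ^ 's) set)"
  shows "0 < y $ i" "y $ i \<le> 1"
proof -
  have "\<delta> < real CARD('s)"
    using \<delta>(2) by (rule less_le_trans) (simp add: Suc_leI)
  then have "0 < 1 - \<delta> / CARD('s)" "0 \<le> 1 - \<delta> / CARD('s)" "1 - \<delta> / CARD('s) \<le> 1"
    using \<delta> by (auto simp: field_simps)
  then show "0 < y $ i" "y $ i \<le> 1"
    using assms by (auto simp: unit_net_def intro!: power_le_one)
qed

text \<open>The condition on \<open>R\<close> says that a box whose exponents sum to at least R s, s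
  being the dimension, has volume at most \<delta>. From below such boxes are approximated by the
  empty box; the vector 0 encodes it and has to be added, as it is not made of powers of the
  ratio.\<close>

lemma unit_net_approx:
  fixes y :: "real ^ 's"
  assumes R: "exp (- \<delta> * real R) \<le> \<delta>" and y: "\<And>i. 0 < y $ i" "\<And>i. y $ i \<le> 1"
  shows unit_net_upper: "\<exists>u\<in>unit_net \<delta> R. (\<forall>i. y $ i \<le> u $ i) \<and> (\<Prod>i\<in>UNIV. u $ i) - (\<Prod>i\<in>UNIV. y $ i) \<le> \<delta>"
    and unit_net_lower: "\<exists>l\<in>insert 0 (unit_net \<delta> R). (\<forall>i. l $ i \<le> y $ i) \<and> (\<Prod>i\<in>UNIV. y $ i) - (\<Prod>i\<in>UNIV. l $ i) \<le> \<delta>"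
proof -
  define q where "q = 1 - \<delta> / CARD('s)"
  have "\<delta> < real CARD('s)"
    using \<delta>(2) by (rule less_le_trans) (simp add: Suc_leI)
  then have q: "0 < q" "q < 1" using \<delta> by (auto simp: q_def field_simps)
  have "\<forall>i. \<exists>n. q ^ Suc n \<le> y $ i \<and> y $ i \<le> q ^ n"
    using exists_power_bracket[OF q] y by blast
  then obtain n where n: "\<And>i. q ^ Suc (n i) \<le> y $ i" "\<And>i. y $ i \<le> q ^ n i" by metis
  define L where "L = R * CARD('s)"
  \<comment> \<open>The summand \<open>CARD('s)\<close> in the budget is the price of rounding down,
    which raises every exponent by one.\<close>
  have mem: "(\<chi> i. q ^ k i) \<in> unit_net \<delta> R" if "sum k UNIV \<le> L + CARD('s)" for k :: "'s \<Rightarrow> nat"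
    using that by (auto simp: unit_net_def q_def L_def)
  have "q ^ L \<le> exp (- \<delta> / CARD('s)) ^ L"
    using q exp_ge_add_one_self[of "- \<delta> / CARD('s)"] by (intro power_mono) (auto simp: q_def)
  also have "\<dots> = exp (- \<delta> * real R)"
    by (simp add: L_def flip: exp_of_nat_mult)
  finally have qL: "q ^ L \<le> \<delta>" using R by linarith
  have bern: "1 - \<delta> \<le> q ^ CARD('s)"
    using Bernoulli_inequality[of "- \<delta> / CARD('s)" "CARD('s)"] q by (simp add: q_def)
  have prod_y: "(\<Prod>i\<in>UNIV. y $ i) \<le> q ^ sum n UNIV" "q ^ (sum n UNIV + CARD('s)) \<le> (\<Prod>i\<in>UNIV. y $ i)"
  proof -
    show "(\<Prod>i\<in>UNIV. y $ i) \<le> q ^ sum n UNIV"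
      using y n by (auto simp: power_sum less_imp_le intro!: prod_mono)
    have "(\<Prod>i\<in>UNIV. q ^ Suc (n i)) \<le> (\<Prod>i\<in>UNIV. y $ i)"
      using y n q by (intro prod_mono) auto
    then show "q ^ (sum n UNIV + CARD('s)) \<le> (\<Prod>i\<in>UNIV. y $ i)"
      by (simp add: prod.distrib power_sum power_add mult.commute)
  qed
  have prod_pos: "0 \<le> (\<Prod>i\<in>UNIV. y $ i)"
    using y by (intro prod_nonneg) (auto intro: less_imp_le)
  have gap: "q ^ sum n UNIV - q ^ (sum n UNIV + CARD('s)) \<le> \<delta>"
  proof -
    have "q ^ sum n UNIV * (1 - q ^ CARD('s)) \<le> 1 * \<delta>"
      using q bern by (intro mult_mono) (auto intro: power_le_one)
    then show ?thesis by (simp add: power_add right_diff_distrib)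
  qed
  show "\<exists>u\<in>unit_net \<delta> R. (\<forall>i. y $ i \<le> u $ i) \<and> (\<Prod>i\<in>UNIV. u $ i) - (\<Prod>i\<in>UNIV. y $ i) \<le> \<delta>"
  proof (cases "sum n UNIV \<le> L")
    case True
    then have "(\<chi> i. q ^ n i) \<in> unit_net \<delta> R" by (intro mem) simp
    moreover have "(\<Prod>i\<in>UNIV. (\<chi> i. q ^ n i) $ i) - (\<Prod>i\<in>UNIV. y $ i) \<le> \<delta>"
      using prod_y gap by (simp only: vec_lambda_beta power_sum[symmetric])
    ultimately show ?thesis using n by (intro bexI[of _ "\<chi> i. q ^ n i"]) auto
  next
    case False
    \<comment> \<open>Smaller exponents enlarge the box, and with exponent sum \<open>L\<close> its
      volume is still at most \<delta>, so it is a good upper approximation whatever the volume of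
      \<open>y\<close>.\<close>
    then obtain k where k: "\<And>i. k i \<le> n i" "sum k UNIV = L"
      using exists_le_function_sum_eq[of L n] by auto
    have "y $ i \<le> q ^ k i" for i
      using n(2)[of i] k(1)[of i] q by (meson order_trans power_decreasing less_imp_le)
    then have "\<forall>i. y $ i \<le> (\<chi> i. q ^ k i) $ i" by simp
    moreover have "(\<chi> i. q ^ k i) \<in> unit_net \<delta> R" using k by (intro mem) simp
    moreover have "(\<Prod>i\<in>UNIV. (\<chi> i. q ^ k i) $ i) - (\<Prod>i\<in>UNIV. y $ i) \<le> \<delta>"
      using k qL prod_pos by (simp only: vec_lambda_beta power_sum[symmetric])
    ultimately show ?thesis by blast
  qed
  show "\<exists>l\<in>insert 0 (unit_net \<delta> R). (\<forall>i. l $ i \<le> y $ i) \<and> (\<Prod>i\<in>UNIV. y $ i) - (\<Prod>i\<in>UNIV. l $ i) \<le> \<delta>"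
  proof (cases "sum n UNIV \<le> L")
    case True
    have eq: "(\<Prod>i\<in>UNIV. q ^ Suc (n i)) = q ^ (sum n UNIV + CARD('s))"
      by (simp add: prod.distrib power_sum power_add mult.commute)
    have "(\<chi> i. q ^ Suc (n i)) \<in> unit_net \<delta> R"
      using True by (intro mem) (simp add: sum.distrib[of n "\<lambda>_. 1", simplified])
    moreover have "\<forall>i. (\<chi> i. q ^ Suc (n i)) $ i \<le> y $ i" using n by simp
    moreover have "(\<Prod>i\<in>UNIV. y $ i) - (\<Prod>i\<in>UNIV. (\<chi> i. q ^ Suc (n i)) $ i) \<le> \<delta>"
      using prod_y gap by (simp only: vec_lambda_beta eq)
    ultimately show ?thesis by blast
  next
    case False
    then have "q ^ sum n UNIV \<le> q ^ L"
      using q by (intro power_decreasing) auto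
    then have "(\<Prod>i\<in>UNIV. y $ i) \<le> \<delta>" using prod_y qL by linarith
    then show ?thesis using y by (intro bexI[of _ 0]) (auto simp: less_imp_le zero_power)
  qed
qed

end

section \<open>Chaining\<close>

lemma exp_half_ge: "13 / 8 \<le> exp (1 / 2 :: real)"
  using exp_lower_Taylor_quadratic[of "1 / 2"] by (simp add: power2_eq_square)

text \<open>The first two factors bound the s-th root of the net size at level m, s being the
  dimension. Up to the factor m the left side grows like 8^m, and 5/2 exceeds ln 8 by enough to
  absorb that factor; the spare 2^m makes the failure weights of the levels summable.\<close>

lemma net_size_le_exp:
  assumes "5 \<le> m"
  shows "exp 1 * (2 * real m * 4 ^ m + 2) * 2 ^ m \<le> 8 * exp (5 * real m / 2)"
  using assms
proof (induction m rule: nat_induct_at_least)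
  case base
  \<comment> \<open>The number is (2 * 5 * 4^5 + 2) * 2^5 / 8.\<close>
  have "40968 \<le> (13 / 8 :: real) ^ 23" by (simp add: power_divide)
  also have "\<dots> \<le> exp (1 / 2) ^ 23" by (intro power_mono exp_half_ge) auto
  also have "\<dots> = exp (23 / 2)" by (subst exp_of_nat_mult[symmetric]) simp
  finally have "exp 1 * 40968 \<le> exp 1 * exp (23 / 2 :: real)" by simp
  also have "\<dots> = exp (25 / 2)" by (simp flip: exp_add)
  finally show ?case by simp
next
  case (Suc m)
  \<comment> \<open>From m to m + 1 the left side grows by a factor of at most 11, the right side by
    exp(5/2).\<close>
  have "11 \<le> (13 / 8 :: real) ^ 5" by (simp add: power_divide)
  also have "\<dots> \<le> exp (1 / 2) ^ 5" by (intro power_mono exp_half_ge) auto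
  also have "\<dots> = exp (5 / 2)" by (subst exp_of_nat_mult[symmetric]) simp
  finally have e: "11 \<le> exp (5 / 2 :: real)" .
  define p where "p = (4 :: real) ^ m"
  have "1 \<le> p" "16 * p \<le> 6 * real m * p"
    using Suc.hyps by (auto simp: p_def intro!: mult_right_mono)
  moreover have "2 * (2 * real (Suc m) * 4 ^ Suc m + 2) = 16 * real m * p + 16 * p + 4"
    "11 * (2 * real m * 4 ^ m + 2) = 22 * real m * p + 22"
    by (simp_all add: p_def algebra_simps)
  ultimately have "2 * (2 * real (Suc m) * 4 ^ Suc m + 2) \<le> 11 * (2 * real m * 4 ^ m + 2)"
    by linarith
  then have "exp 1 * 2 ^ m * (2 * (2 * real (Suc m) * 4 ^ Suc m + 2))
      \<le> exp 1 * 2 ^ m * (11 * (2 * real m * 4 ^ m + 2))"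
    by (intro mult_left_mono) auto
  also have "\<dots> = 11 * (exp 1 * (2 * real m * 4 ^ m + 2) * 2 ^ m)" by simp
  also have "\<dots> \<le> exp (5 / 2) * (8 * exp (5 * real m / 2))"
    using mult_mono[OF e Suc.IH] by simp
  also have "\<dots> = 8 * exp (5 * real (Suc m) / 2)"
    by (simp add: algebra_simps add_divide_distrib flip: exp_add)
  finally show ?case by (simp only: power_Suc mult_ac)
qed

text \<open>The condition of \<open>unit_net_approx\<close> for \<delta> = 4^(-m): the choice R = 2
  m 4^m gives \<delta> R = 2 m, and exp(-2) \<le> 1/4.\<close>

lemma exp_neg_le_quarter_power: "exp (- ((1 / 4) ^ m) * real (2 * m * 4 ^ m)) \<le> (1 / 4 :: real) ^ m"
proof -
  have "(4 :: real) \<le> (13 / 8) ^ 4" by (simp add: power_divide)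
  also have "\<dots> \<le> exp (1 / 2) ^ 4" by (intro power_mono exp_half_ge) auto
  also have "\<dots> = exp 2" by (subst exp_of_nat_mult[symmetric]) simp
  finally have "exp (- 2 :: real) \<le> 1 / 4" by (simp add: exp_minus field_simps)
  then have "exp (- 2 :: real) ^ m \<le> (1 / 4) ^ m" by (intro power_mono) auto
  moreover have "- ((1 / 4) ^ m) * real (2 * m * 4 ^ m) = real m * (- 2)"
    by (simp add: power_divide)
  ultimately show ?thesis by (simp only: exp_of_nat_mult)
qed

text \<open>Total failure weight of all levels. Level 5 is the first start for which it stays below
  1.\<close>

lemma sum_sixteen_div_power_two:
  "5 \<le> K \<Longrightarrow> (\<Sum>m=5..K. 16 / 2 ^ m :: real) = 1 - 16 / 2 ^ K"
  by (induction K rule: nat_induct_at_least) (auto simp: sum.nat_ivl_Suc' field_simps)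

text \<open>The constant is 39/5 for the chain plus 1 for the final approximation. Being smaller
  than 9, it lets a bound for each single box give a strict bound for the supremum.\<close>

lemma exists_points_uniform_deviation:
  fixes N :: nat
  defines "\<epsilon> \<equiv> sqrt (real CARD('s) / real N)"
  assumes N: "N \<ge> 1" and \<epsilon>: "\<epsilon> \<le> 1 / 9"
  shows "\<exists>z :: nat \<Rightarrow> real ^ 's. (\<forall>n. z n \<in> cbox 0 1) \<and>
    (\<forall>a\<in>cbox 0 1. \<bar>real (box_count N z (anchored_box a)) - real N * measure lebesgue (anchored_box a)\<bar>
      \<le> real N * (44 / 5 * \<epsilon>))"
proof -
  define s where "s = CARD('s)"
  have s: "1 \<le> s" by (simp add: s_def Suc_leI)
  have \<epsilon>0: "0 < \<epsilon>" using N by (simp add: \<epsilon>_def)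
  have N\<epsilon>: "real N * \<epsilon>\<^sup>2 = real s" using N by (simp add: \<epsilon>_def s_def)
  define P :: "nat \<Rightarrow> (real ^ 's) set" where "P m = unit_net ((1 / 4) ^ m) (2 * m * 4 ^ m)" for m
  have quarter: "0 < (1 / 4 :: real) ^ m" "(1 / 4 :: real) ^ m < 1" if "5 \<le> m" for m
    using that by (auto intro: power_less_one_iff[THEN iffD2])
  have fin_P: "finite (P m)" for m by (simp add: P_def finite_unit_net)
  have P_range: "0 < y $ i" "y $ i \<le> 1" if "y \<in> P m" "5 \<le> m" for y m i
    using that unit_net_range[OF quarter] unfolding P_def by blast+
  let ?\<mu> = "\<lambda>a :: real ^ 's. measure lebesgue (anchored_box a)"
  have upper: "\<exists>u\<in>P m. (\<forall>i. y $ i \<le> u $ i) \<and> ?\<mu> u - ?\<mu> y \<le> (1 / 4) ^ m"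
    and lower: "\<exists>l\<in>insert 0 (P m). (\<forall>i. l $ i \<le> y $ i) \<and> ?\<mu> y - ?\<mu> l \<le> (1 / 4) ^ m"
    if m: "5 \<le> m" and y: "\<And>i. 0 < y $ i" "\<And>i. y $ i \<le> 1" for y m
  proof -
    have vol: "?\<mu> u = (\<Prod>i\<in>UNIV. u $ i)" if "u \<in> insert 0 (insert y (P m))" for u
      using that P_range[OF _ m] y by (intro measure_anchored_box) (auto simp: less_imp_le)
    obtain u where "u \<in> P m" "\<forall>i. y $ i \<le> u $ i"
      "(\<Prod>i\<in>UNIV. u $ i) - (\<Prod>i\<in>UNIV. y $ i) \<le> (1 / 4) ^ m"
      using unit_net_upper[OF quarter[OF m] exp_neg_le_quarter_power y] unfolding P_def by blast
    moreover from this have "?\<mu> u = (\<Prod>i\<in>UNIV. u $ i)" "?\<mu> y = (\<Prod>i\<in>UNIV. y $ i)"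
      by - (rule vol, blast)+
    ultimately show "\<exists>u\<in>P m. (\<forall>i. y $ i \<le> u $ i) \<and> ?\<mu> u - ?\<mu> y \<le> (1 / 4) ^ m"
      by (intro bexI[of _ u]) simp_all
    obtain l where "l \<in> insert 0 (P m)" "\<forall>i. l $ i \<le> y $ i"
      "(\<Prod>i\<in>UNIV. y $ i) - (\<Prod>i\<in>UNIV. l $ i) \<le> (1 / 4) ^ m"
      using unit_net_lower[OF quarter[OF m] exp_neg_le_quarter_power y] unfolding P_def by blast
    moreover from this have "?\<mu> l = (\<Prod>i\<in>UNIV. l $ i)" "?\<mu> y = (\<Prod>i\<in>UNIV. y $ i)"
      by - (rule vol, blast)+
    ultimately show "\<exists>l\<in>insert 0 (P m). (\<forall>i. l $ i \<le> y $ i) \<and> ?\<mu> y - ?\<mu> l \<le> (1 / 4) ^ m"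
      by (intro bexI[of _ l]) simp_all
  qed
  \<comment> \<open>Predecessors are obtained by rounding down, so that boxes are nested and the
    increment is itself a set, whose count and measure are differences.\<close>
  have "\<forall>m y. \<exists>l. 5 \<le> m \<longrightarrow> y \<in> P (Suc m) \<longrightarrow>
      l \<in> insert 0 (P m) \<and> (\<forall>i. l $ i \<le> y $ i) \<and> ?\<mu> y - ?\<mu> l \<le> (1 / 4) ^ m"
    using lower P_range by (meson le_SucI)
  then obtain low where low: "\<And>m y. 5 \<le> m \<Longrightarrow> y \<in> P (Suc m) \<Longrightarrow>
      low m y \<in> insert 0 (P m) \<and> (\<forall>i. low m y $ i \<le> y $ i) \<and> ?\<mu> y - ?\<mu> (low m y) \<le> (1 / 4) ^ m"
    by metis
  \<comment> \<open>Tangent of $\sqrt{5m/2}$ at its value $4$: then $e^{-s \tau_m^2}$ beats the size of the net of level $m$.\<close>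
  define \<tau> where "\<tau> m = 2 + 5 * real m / 16" for m
  have \<tau>: "5 * real m / 2 \<le> (\<tau> m)\<^sup>2" for m
    using zero_le_power2[of "2 - 5 * real m / 16"] by (simp add: \<tau>_def power2_eq_square algebra_simps)
  \<comment> \<open>\<open>lam m\<close> is close to the minimizer of \<open>p * lam m + 5 * m / 2 * \<epsilon>\<^sup>2 / lam m\<close> for sets of measure
    \<open>p = 4 ^ (1 - m)\<close> (\<open>p = 1\<close> at the bottom level), and \<open>t m\<close> is about the minimum.\<close>
  define lam where "lam m = (if m = 5 then 18 / 5 * \<epsilon> else \<epsilon> * 2 ^ (m - 1) * \<tau> m)" for m
  define t where "t m = (if m = 5 then 36 / 5 * \<epsilon> else 2 * \<epsilon> * \<tau> m / 2 ^ (m - 1))" for m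
  define S where "S m y = (if m = 5 then anchored_box y else anchored_box y - anchored_box (low (m - 1) y))" for m y
  have "\<exists>K. (1 / 4) ^ K < \<epsilon>" using real_arch_pow_inv[OF \<epsilon>0, of "1 / 4"] by simp
  then obtain K0 where "(1 / 4) ^ K0 < \<epsilon>" ..
  then have "(1 / 4) ^ (K0 + 5) \<le> \<epsilon>"
    by (rule less_imp_le[OF le_less_trans[rotated]]) (auto intro: power_decreasing)
  then have ex: "\<exists>K. 5 \<le> K \<and> (1 / 4) ^ K \<le> \<epsilon>" by (intro exI[of _ "K0 + 5"]) auto
  define K where "K = (LEAST K. 5 \<le> K \<and> (1 / 4) ^ K \<le> \<epsilon>)"
  have K: "5 \<le> K" "(1 / 4) ^ K \<le> \<epsilon>" using LeastI_ex[OF ex] by (auto simp: K_def)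
  \<comment> \<open>Minimality of \<open>K\<close> is used to keep the rates admissible: beyond the
    bottom level, \<open>lam m \<le> 1\<close> rests on \<epsilon> < 4^(1-m), that is, on level m -
    1 not yet being fine enough.\<close>
  have above: "\<epsilon> < (1 / 4) ^ m" if "5 \<le> m" "m < K" for m
    using not_less_Least[of m "\<lambda>K. 5 \<le> K \<and> (1 / 4) ^ K \<le> \<epsilon>"] that by (auto simp: K_def)
  have lam: "0 < lam m \<and> lam m \<le> 1" if m: "m \<in> {5..K}" for m
  proof (cases "m = 5")
    case True
    then show ?thesis using \<epsilon> \<epsilon>0 by (simp add: lam_def)
  next
    case False
    then obtain k where k: "m = Suc k" "5 \<le> k" "k < K" using m by (cases m) auto
    have "\<epsilon> * 2 ^ k * \<tau> m \<le> (1 / 4) ^ k * 2 ^ k * \<tau> m"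
      using above[of k] k by (intro mult_right_mono) (auto simp: \<tau>_def)
    also have "\<dots> = \<tau> m / 2 ^ k"
      by (simp add: power_divide field_simps flip: power_mult_distrib)
    also have "\<dots> \<le> 1"
    proof -
      have "real (Suc k) \<le> 2 ^ k" using of_nat_mono[OF Suc_leI[OF less_exp[of k]], where 'a = real] by simp
      moreover have "\<tau> m \<le> real (Suc k)" using k by (simp add: \<tau>_def field_simps)
      ultimately show ?thesis by simp
    qed
    finally show ?thesis using False \<epsilon>0 k by (simp add: lam_def \<tau>_def add_pos_nonneg)
  qed
  have low_sub: "anchored_box (low m y) \<subseteq> anchored_box y" if "5 \<le> m" "y \<in> P (Suc m)" for m y
    using low[OF that] by (intro anchored_box_mono) auto
  have unit: "y \<in> cbox 0 1" if "y \<in> insert 0 (P m)" "5 \<le> m" for y m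
    using that P_range[of y m] by (auto simp: mem_box_cart less_imp_le)
  have S_sub: "S m y \<subseteq> cbox 0 1" if "m \<in> {5..K}" "y \<in> P m" for m y
  proof -
    have "y \<in> cbox 0 1" using that by (intro unit[of y m]) auto
    then have "anchored_box y \<subseteq> cbox 0 1" by (rule anchored_box_subset_unit)
    then show ?thesis by (auto simp: S_def)
  qed
  have S_diff: "measure lebesgue (S (Suc m) y) = ?\<mu> y - ?\<mu> (low m y)" if "5 \<le> m" "y \<in> P (Suc m)" for m y
  proof -
    have "S (Suc m) y = anchored_box y - anchored_box (low m y)"
      using that(1) by (simp add: S_def)
    moreover have "y \<in> cbox 0 1" "low m y \<in> cbox 0 1"
      using low[OF that] that by (auto intro: unit[of y "Suc m"] unit[of "low m y" m] simp del: insert_iff)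
    ultimately show ?thesis
      using measurable_measure_Diff[OF anchored_box_lmeasurable fmeasurableD[OF anchored_box_lmeasurable] low_sub[OF that]]
      by (simp only:)
  qed

  \<comment> \<open>Union bound over all levels\<close>
  have exponent: "real N * ((lam m)\<^sup>2 * measure lebesgue (S m y) - lam m * t m) \<le> - (5 * real m / 2) * real s"
    if m: "m \<in> {5..K}" "y \<in> P m" for m y
  proof (cases "m = 5")
    case True
    have y: "0 \<le> y $ i" "y $ i \<le> 1" for i
      using P_range[OF m(2), of i] m(1) less_imp_le[of 0 "y $ i"] by auto
    have "S m y = anchored_box y" using True by (simp add: S_def)
    then have "measure lebesgue (S m y) = (\<Prod>i\<in>UNIV. y $ i)"
      using measure_anchored_box[of y, OF y(1)] by (simp only:)
    also have "\<dots> \<le> 1"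
      by (intro prod_le_1) (simp add: y)
    finally have "(lam m)\<^sup>2 * measure lebesgue (S m y) \<le> (lam m)\<^sup>2"
      by (simp add: mult_left_le)
    \<comment> \<open>The rate 18/5 is slightly above sqrt(25/2): using only that the measure is at
      most 1, the exponent is at most -(18/5)^2 s, and (18/5)^2 = 12.96 exceeds 25/2.\<close>
    moreover have "(lam m)\<^sup>2 = 324 / 25 * \<epsilon>\<^sup>2" "lam m * t m = 648 / 25 * \<epsilon>\<^sup>2"
      using True by (simp_all add: lam_def t_def power2_eq_square)
    ultimately have "(lam m)\<^sup>2 * measure lebesgue (S m y) - lam m * t m \<le> - (324 / 25) * \<epsilon>\<^sup>2"
      by linarith
    then have "real N * ((lam m)\<^sup>2 * measure lebesgue (S m y) - lam m * t m) \<le> real N * (- (324 / 25) * \<epsilon>\<^sup>2)"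
      by (intro mult_left_mono) auto
    also have "\<dots> = - (324 / 25) * real s" using N\<epsilon> by (simp add: algebra_simps)
    also have "\<dots> \<le> - (5 * real m / 2) * real s" using True by (intro mult_right_mono) auto
    finally show ?thesis .
  next
    case False
    then obtain k where k: "m = Suc k" "5 \<le> k" using m by (cases m) auto
    have "measure lebesgue (S m y) \<le> (1 / 4) ^ k"
      using S_diff[of k y] low[of k y] k m by simp
    then have "(lam m)\<^sup>2 * measure lebesgue (S m y) \<le> (lam m)\<^sup>2 * (1 / 4) ^ k"
      by (intro mult_left_mono) auto
    \<comment> \<open>The rate cancels the measure 4^(-k), so that the quadratic term is exactly
      half of the linear term \<open>lam m * t m\<close>.\<close>
    also have "\<dots> = \<epsilon>\<^sup>2 * (\<tau> m)\<^sup>2"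
    proof -
      have "((2 :: real) ^ k)\<^sup>2 = 4 ^ k"
        by (simp add: power2_eq_square flip: power_mult_distrib)
      then have "((2 :: real) ^ k)\<^sup>2 * (1 / 4) ^ k = 1"
        by (simp add: power_divide)
      then show ?thesis using False k by (simp add: lam_def power_mult_distrib)
    qed
    also have "\<epsilon>\<^sup>2 * (\<tau> m)\<^sup>2 = lam m * t m - (\<tau> m)\<^sup>2 * \<epsilon>\<^sup>2"
      using False by (simp add: lam_def t_def power2_eq_square)
    finally have "(lam m)\<^sup>2 * measure lebesgue (S m y) - lam m * t m \<le> - ((\<tau> m)\<^sup>2) * \<epsilon>\<^sup>2"
      by simp
    then have "real N * ((lam m)\<^sup>2 * measure lebesgue (S m y) - lam m * t m) \<le> real N * (- ((\<tau> m)\<^sup>2) * \<epsilon>\<^sup>2)"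
      by (intro mult_left_mono) auto
    also have "\<dots> = - ((\<tau> m)\<^sup>2) * real s" using N\<epsilon> by (simp add: algebra_simps)
    also have "\<dots> \<le> - (5 * real m / 2) * real s" using \<tau> by (intro mult_right_mono) auto
    finally show ?thesis .
  qed
  have level: "(\<Sum>y\<in>P m. 2 * exp (real N * ((lam m)\<^sup>2 * measure lebesgue (S m y) - lam m * t m))) \<le> 16 / 2 ^ m"
    if m: "m \<in> {5..K}" for m
  proof -
    define b where "b = exp 1 * (2 * real m * 4 ^ m + 2)"
    have "(\<Sum>y\<in>P m. 2 * exp (real N * ((lam m)\<^sup>2 * measure lebesgue (S m y) - lam m * t m)))
        \<le> (\<Sum>y\<in>P m. 2 * exp (- (5 * real m / 2) * real s))"
      using exponent[OF m] by (intro sum_mono) simp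
    also have "\<dots> = 2 * (real (card (P m)) * exp (- (5 * real m / 2)) ^ s)"
      by (simp only: exp_of_nat2_mult sum_constant)
    also have "\<dots> \<le> 2 * (b ^ s * exp (- (5 * real m / 2)) ^ s)"
      using card_unit_net_le[of "(1 / 4) ^ m" "2 * m * 4 ^ m", where 's = 's]
      by (intro mult_left_mono mult_right_mono) (auto simp: P_def b_def s_def)
    also have "\<dots> = 2 * (b * exp (- (5 * real m / 2))) ^ s" by (simp add: power_mult_distrib)
    also have "\<dots> \<le> 2 * (8 / 2 ^ m) ^ s"
      using net_size_le_exp[of m] m
      by (intro mult_left_mono power_mono) (auto simp: b_def exp_minus field_simps)
    \<comment> \<open>The base is at most 1 since m \<ge> 3, so its power is largest for s = 1; the
      bound no longer depends on the dimension.\<close>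
    also have "\<dots> \<le> 2 * (8 / 2 ^ m)"
    proof -
      have "(2 :: real) ^ 3 \<le> 2 ^ m" using m by (intro power_increasing) auto
      then have "(8 / 2 ^ m :: real) ^ s \<le> (8 / 2 ^ m) ^ 1"
        using s by (intro power_decreasing) auto
      then show ?thesis by simp
    qed
    finally show ?thesis by simp
  qed
  define J where "J = Sigma {5..K} P"
  have "(\<Sum>(m, y)\<in>J. 2 * exp (real N * ((lam m)\<^sup>2 * measure lebesgue (S m y) - lam m * t m)))
      \<le> (\<Sum>m=5..K. 16 / 2 ^ m)"
    unfolding J_def using fin_P level by (subst sum.Sigma[symmetric]) (auto intro!: sum_mono)
  also have "\<dots> < 1" using sum_sixteen_div_power_two[OF K(1)] by simp
  finally have less: "(\<Sum>j\<in>J. 2 * exp (real N * ((lam (fst j))\<^sup>2 * measure lebesgue (S (fst j) (snd j)) - lam (fst j) * t (fst j)))) < 1"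
    by (simp add: case_prod_beta)
  obtain z :: "nat \<Rightarrow> real ^ 's" where z: "\<And>n. z n \<in> cbox 0 1"
    and "\<forall>j\<in>J. \<bar>real (box_count N z (S (fst j) (snd j))) - real N * measure lebesgue (S (fst j) (snd j))\<bar> < real N * t (fst j)"
    using exists_unit_cube_points_deviation_less[of J "\<lambda>j. S (fst j) (snd j)" "\<lambda>j. lam (fst j)" N "\<lambda>j. t (fst j)", OF _ _ _ _ less]
      fin_P S_sub lam by (fastforce simp: J_def S_def)
  then have dev_S: "\<bar>real (box_count N z (S m y)) - real N * measure lebesgue (S m y)\<bar> \<le> real N * t m"
    if "m \<in> {5..K}" "y \<in> P m" for m y
    using that by (force simp: J_def)

  \<comment> \<open>From the net boxes to arbitrary boxes\<close>
  define dev where "dev a = real (box_count N z (anchored_box a)) - real N * ?\<mu> a" for a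
  have empty: "dev a = 0" if "a $ i \<le> 0" for a i
    using anchored_box_eq_empty[OF that] by (simp add: dev_def box_count_def)
  have chain: "\<bar>dev y\<bar> \<le> real N * (\<Sum>k=5..m. t k)" if "5 \<le> m" "m \<le> K" "y \<in> P m" for m y
    using that
  proof (induction m arbitrary: y rule: nat_induct_at_least)
    case base
    then show ?case using dev_S[of 5 y] by (simp add: S_def dev_def)
  next
    case (Suc m)
    have t0: "0 \<le> t k" for k using \<epsilon>0 by (simp add: t_def \<tau>_def)
    \<comment> \<open>A predecessor outside the net is the vector 0; its box is empty and deviates
      by 0.\<close>
    have "\<bar>dev (low m y)\<bar> \<le> real N * (\<Sum>k=5..m. t k)"
      using low[of m y] Suc empty[of 0] t0 by (auto simp: sum_nonneg)
    moreover have "dev y = dev (low m y) + (real (box_count N z (S (Suc m) y)) - real N * measure lebesgue (S (Suc m) y))"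
    proof -
      have "S (Suc m) y = anchored_box y - anchored_box (low m y)" using Suc.hyps by (simp add: S_def)
      then have "real (box_count N z (S (Suc m) y))
          = real (box_count N z (anchored_box y)) - real (box_count N z (anchored_box (low m y)))"
        using box_count_Diff[OF low_sub[OF Suc.hyps Suc.prems(2)]] by (simp only:)
      then show ?thesis
        unfolding dev_def S_diff[OF Suc.hyps Suc.prems(2)] right_diff_distrib by linarith
    qed
    moreover have "\<bar>real (box_count N z (S (Suc m) y)) - real N * measure lebesgue (S (Suc m) y)\<bar> \<le> real N * t (Suc m)"
      using Suc by (intro dev_S) auto
    ultimately show ?case using Suc.hyps by (simp add: sum.nat_ivl_Suc' distrib_left)
  qed
  \<comment> \<open>Here 67/128 is the total of all thresholds above level 5 in units of \<epsilon>,
    and the subtracted fraction is the part of it beyond level m.\<close>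
  have "(\<Sum>k=5..m. t k) = \<epsilon> * (36 / 5 + 67 / 128 - (21 / 4 + 5 * real m / 8) / 2 ^ (m - 1))" if "5 \<le> m" for m
    using that
  proof (induction m rule: nat_induct_at_least)
    case base
    then show ?case by (simp add: t_def)
  next
    case (Suc m)
    have "(2 :: real) ^ m = 2 * 2 ^ (m - 1)"
      using Suc.hyps by (simp flip: power_Suc)
    then have "(21 / 4 + 5 * real m / 8) / 2 ^ (m - 1) = (21 / 2 + 5 * real m / 4) / 2 ^ m"
      by (simp add: field_simps)
    moreover have "t (Suc m) = \<epsilon> * ((4 + 5 * (real m + 1) / 8) / 2 ^ m)"
      using Suc.hyps by (simp add: t_def \<tau>_def field_simps)
    moreover have "(21 / 4 + 5 * real (Suc m) / 8) / 2 ^ m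
        = (21 / 2 + 5 * real m / 4) / 2 ^ m - (4 + 5 * (real m + 1) / 8) / 2 ^ m"
      by (simp add: field_simps flip: diff_divide_distrib)
    ultimately show ?case
      using Suc by (simp add: sum.nat_ivl_Suc' right_diff_distrib distrib_left)
  qed
  from this[OF K(1)] have "(\<Sum>k=5..K. t k) \<le> \<epsilon> * (36 / 5 + 67 / 128)"
    using \<epsilon>0 by (simp add: mult_left_mono)
  also have "\<dots> \<le> 39 / 5 * \<epsilon>" using \<epsilon>0 by simp
  finally have "(\<Sum>k=5..K. t k) + (1 / 4) ^ K \<le> 44 / 5 * \<epsilon>"
    using K(2) \<epsilon>0 by linarith
  then have total: "real N * (\<Sum>k=5..K. t k) + real N * (1 / 4) ^ K \<le> real N * (44 / 5 * \<epsilon>)"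
    unfolding distrib_left[symmetric] by (intro mult_left_mono) auto
  have "\<bar>dev a\<bar> \<le> real N * (44 / 5 * \<epsilon>)" if a: "a \<in> cbox 0 1" for a
  \<comment> \<open>A vanishing coordinate makes the box empty; rounding to powers needs positive
    coordinates.\<close>
  proof (cases "\<exists>i. a $ i \<le> 0")
    case True
    then show ?thesis using empty \<epsilon>0 by auto
  next
    case False
    then have pos: "0 < a $ i" "a $ i \<le> 1" for i
      using a by (auto simp: mem_box_cart not_le)
    obtain u where u: "u \<in> P K" "\<And>i. a $ i \<le> u $ i" "?\<mu> u - ?\<mu> a \<le> (1 / 4) ^ K"
      using upper[OF K(1) pos] by auto
    obtain l where l: "l \<in> insert 0 (P K)" "\<And>i. l $ i \<le> a $ i" "?\<mu> a - ?\<mu> l \<le> (1 / 4) ^ K"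
      using lower[OF K(1) pos] by blast
    have "\<bar>dev u\<bar> \<le> real N * (\<Sum>k=5..K. t k)" using chain[OF K(1)] u by simp
    moreover have "\<bar>dev l\<bar> \<le> real N * (\<Sum>k=5..K. t k)"
      using chain[OF K(1) order_refl] l(1) empty[of 0] calculation by force
    moreover have "box_count N z (anchored_box l) \<le> box_count N z (anchored_box a)"
      "box_count N z (anchored_box a) \<le> box_count N z (anchored_box u)"
      using u l by (auto intro!: box_count_mono anchored_box_mono)
    moreover have "real N * (?\<mu> u - ?\<mu> a) \<le> real N * (1 / 4) ^ K" "real N * (?\<mu> a - ?\<mu> l) \<le> real N * (1 / 4) ^ K"
      using u l by (auto intro!: mult_left_mono)
    ultimately show ?thesis
      using total unfolding dev_def right_diff_distrib by linarith
  qed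
  then show ?thesis using z by (auto simp: dev_def)
qed

section \<open>Passage to the star-discrepancy\<close>

theorem theorem1:
  fixes N :: nat
  assumes "N \<ge> 1"
  shows "\<exists>z :: nat \<Rightarrow> real ^ 's.
           (\<forall>n\<in>{1..N}. z n \<in> cbox 0 1) \<and>
           star_discrepancy N z < 9 * (sqrt (real CARD('s)) / sqrt (real N))"
proof -
  define \<epsilon> where "\<epsilon> = sqrt (real CARD('s) / real N)"
  have \<epsilon>0: "0 < \<epsilon>" using assms by (simp add: \<epsilon>_def)
  have ne: "anchored_box ` cbox 0 (1 :: real ^ 's) \<noteq> {}"
    by (simp add: interval_ne_empty_cart)
  have "\<exists>z :: nat \<Rightarrow> real ^ 's. (\<forall>n. z n \<in> cbox 0 1) \<and> star_discrepancy N z < 9 * \<epsilon>"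
  proof (cases "\<epsilon> \<le> 1 / 9")
    case True
    obtain z :: "nat \<Rightarrow> real ^ 's" where z: "\<And>n. z n \<in> cbox 0 1"
      and dev: "\<And>a. a \<in> cbox 0 1 \<Longrightarrow>
        \<bar>real (box_count N z (anchored_box a)) - real N * measure lebesgue (anchored_box a)\<bar> \<le> real N * (44 / 5 * \<epsilon>)"
      using exists_points_uniform_deviation[OF assms, where 's = 's] True unfolding \<epsilon>_def by blast
    have "\<bar>real (box_count N z (anchored_box a)) / real N - measure lebesgue (anchored_box a)\<bar> \<le> 44 / 5 * \<epsilon>"
      if "a \<in> cbox 0 1" for a
    proof -
      have "real N * \<bar>real (box_count N z (anchored_box a)) / real N - measure lebesgue (anchored_box a)\<bar>
          = \<bar>real N * (real (box_count N z (anchored_box a)) / real N - measure lebesgue (anchored_box a))\<bar>"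
        by (simp add: abs_mult)
      also have "\<dots> = \<bar>real (box_count N z (anchored_box a)) - real N * measure lebesgue (anchored_box a)\<bar>"
        using assms by (simp add: right_diff_distrib)
      also have "\<dots> \<le> real N * (44 / 5 * \<epsilon>)" by (rule dev[OF that])
      finally show ?thesis using assms by simp
    qed
    then have "star_discrepancy N z \<le> 44 / 5 * \<epsilon>"
      unfolding star_discrepancy_def using ne by (intro cSUP_least) auto
    then show ?thesis using z \<epsilon>0 by (intro exI[of _ z]) auto
  next
    case False
    have "star_discrepancy N (\<lambda>_. 0 :: real ^ 's) \<le> 1"
      unfolding star_discrepancy_def using ne star_discrepancy_bdd[where 's = 's] by (intro cSUP_least) auto
    then show ?thesis using False by (intro exI[of _ "\<lambda>_. 0"]) (auto simp: mem_box_cart)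
  qed
  then show ?thesis by (auto simp: \<epsilon>_def real_sqrt_divide)
qed

end
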